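(* Let $h_0>0$ satisfy $$\frac{(T_0-T_{0l})k_l}{(T_{0l}-T_\infty)\sqrt{\pi \alpha_l}}<h_0<\frac{(T_0-T_{0s})k_l}{(T_{0s}-T_\infty)\sqrt{\pi \alpha_l}},$$ let $(\delta,\widehat T_k)$ be the pair determining the similarity solution of problem $(P_2)$ (see the context), and let $$T_1=\widehat T_k-\frac{h_0\sqrt{\pi\alpha_s}\,\mathrm{erf}(\delta)(\widehat T_k-T_\infty)}{k_s+h_0\sqrt{\pi\alpha_s}\,\mathrm{erf}(\delta)}$$ be the corresponding temperature at $x=0$. Then the coefficient $\mu$ of the free boundary $\widetilde s(t)=2\mu\sqrt{\alpha_st}$ and the solidification temperature $\widetilde T_k$ of the Rubinstein solution of problem $(P_R)$ with this value of $T_1$ satisfy $$\frac{\sqrt{\alpha_l}}{\sqrt{\alpha_s}}\,\frac{k_s}{k_l}\,\frac{\widetilde T_k-T_1}{T_0-T_{0s}}\,\frac{T_{0s}-T_\infty}{T_1-T_\infty}<\mathrm{erf}(\mu)<\frac{\sqrt{\alpha_l}}{\sqrt{\alpha_s}}\,\frac{k_s}{k_l}\,\frac{\widetilde T_k-T_1}{T_0-T_{0l}}\,\frac{T_{0l}-T_\infty}{T_1-T_\infty}.$$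
   Context: Data. $\alpha_s,\alpha_l,d_s,d_l,k_s,k_l,\rho,\gamma$ are positive constants (subscripts $s$, $l$: solid, liquid). $T_A<T_B$ are real numbers, and $f_l,f_s:[T_A,T_B]\to\mathbb R$ are continuous strictly increasing functions with $$f_l(T_A)=f_s(T_A)<f_l(T)<f_s(T)<f_l(T_B)=f_s(T_B),\quad T_A<T<T_B.$$ $C_0$ is a constant with $f_l(T_A)<C_0<f_l(T_B)$, and $T_{0l}=f_l^{-1}(C_0)$, $T_{0s}=f_s^{-1}(C_0)$. $T_0$ is a constant with $T_A<T_0<T_B$. The alloy is initially liquid, i.e. $C_0<f_l(T_0)$. $T_\infty$ is a real constant (the bulk temperature), such that the two bounds on $h_0$ are defined. Problem $(P_2)$. Find $s(t)>0$ ($t>0$), a constant $T_k\in(T_A,T_B)$, functions $T_s,C_s$ on $0<x<s(t)$, $t>0$, and $T_l,C_l$ on $x>s(t)$, $t>0$, such that, for all $t>0$: (i) $\alpha_s T_{s,xx}=T_{s,t}$ for $0<x<s(t)$; (ii) $\alpha_l T_{l,xx}=T_{l,t}$ for $x>s(t)$; (iii) $d_s C_{s,xx}=C_{s,t}$ for $0<x<s(t)$; (iv) $d_l C_{l,xx}=C_{l,t}$ for $x>s(t)$; (v) $k_s T_{s,x}(0,t)=\frac{h_0}{\sqrt t}(T_s(0,t)-T_\infty)$; (vi) $T_s(s(t),t)=T_l(s(t),t)=T_k$; (vii) $T_l(x,0)=T_0$ for $x>0$; (viii) $T_l(\infty,t)=T_0$; (ix) $C_{s,x}(0,t)=0$;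 (x) $C_s(s(t),t)=f_s(T_k)$; (xi) $C_l(x,0)=C_0$ for $x>0$; (xii) $C_l(s(t),t)=f_l(T_k)$; (xiii) $k_sT_{s,x}(s(t),t)-k_lT_{l,x}(s(t),t)=\gamma\rho s'(t)$; (xiv) $d_lC_{l,x}(s(t),t)-d_sC_{s,x}(s(t),t)=[f_s(T_k)-f_l(T_k)]s'(t)$. Problem $(P_R)$ is obtained from $(P_2)$ by replacing (v) by the condition that the solid temperature at $x=0$ equals the constant $T_1$ for all $t>0$. Functions. $\mathrm{erf}(x)=\frac{2}{\sqrt\pi}\int_0^x e^{-t^2}dt$, $\mathrm{erfc}=1-\mathrm{erf}$; write $c=\sqrt{\alpha_s/\alpha_l}$. For $x>0$: $$Q(x)=\sqrt{\pi}\,x e^{x^2}\mathrm{erfc}(x),\quad Q_1(x)=\sqrt\pi\,xe^{x^2}\mathrm{erf}(x),\quad F_1(x)=e^{x^2}\mathrm{erfc}(x),\quad M(x)=\Big[Q\big(\sqrt{\alpha_s/d_l}\,x\big)\Big]^{-1},$$ $$F_2(x)=\frac{h_0k_s\sqrt{\pi\alpha_l}\,e^{-x^2}F_1(cx)}{k_l(k_s+h_0\sqrt{\pi\alpha_s}\,\mathrm{erf}(x))},\quad H(x)=\frac{h_0k_s\sqrt{\pi\alpha_l}}{xe^{x^2}(k_s+h_0\sqrt{\pi\alpha_s}\,\mathrm{erf}(x))}+\frac{k_l\sqrt{\pi\alpha_s}}{\sqrt{\alpha_l}\,Q(cx)},$$ $$W(x)=T_\infty+\frac{T_0-T_\infty}{F_2(x)+1}+\frac{\gamma\rho\sqrt{\pi\alpha_s\alpha_l}}{H(x)},$$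 $$G(x)=\frac{\gamma\rho\alpha_s\alpha_lQ_1(x)Q(cx)+T_1k_s\alpha_lQ(cx)+T_0k_l\alpha_sQ_1(x)}{k_s\alpha_lQ(cx)+k_l\alpha_sQ_1(x)},$$ and $\phi(x)=\frac{f_s(x)-f_l(x)}{C_0-f_l(x)}$ for $x\in(T_A,T_{0l})\cup(T_{0l},T_B)$. The similarity solution of $(P_2)$ has $\widehat s(t)=2\delta\sqrt{\alpha_st}$ and $\widehat T_s(x,t)=\widehat T_k+\frac{h_0\sqrt{\pi\alpha_s}(\widehat T_k-T_\infty)}{k_s+h_0\sqrt{\pi\alpha_s}\,\mathrm{erf}(\delta)}\big(\mathrm{erf}\big(\frac{x}{2\sqrt{\alpha_st}}\big)-\mathrm{erf}(\delta)\big)$, where $(\delta,\widehat T_k)$ is the unique pair with $\widehat T_k=W(\delta)$, $M(\delta)=\phi(\widehat T_k)$, $\delta>0$, $T_A<\widehat T_k<T_B$. The Rubinstein solution of $(P_R)$ has $\widetilde s(t)=2\mu\sqrt{\alpha_st}$ and $\widetilde T_s(x,t)=T_1+\frac{\widetilde T_k-T_1}{\mathrm{erf}(\mu)}\mathrm{erf}\big(\frac{x}{2\sqrt{\alpha_st}}\big)$, where $(\mu,\widetilde T_k)$ is the (unique) pair with $\widetilde T_k=G(\mu)$, $M(\mu)=\phi(\widetilde T_k)$, $\mu>0$, $T_A<\widetilde T_k<T_B$. *)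

theory Defs
  imports "HOL-Analysis.Analysis"
begin

definition erf :: "real \<Rightarrow> real" where
  "erf x = 2 / sqrt pi * (LBINT t=0..ereal x. exp (- t\<^sup>2))"

definition erfc :: "real \<Rightarrow> real" where
  "erfc x = 1 - erf x"

text \<open>
  The data of the binary alloy: subscripts \<open>s\<close> and \<open>l\<close> stand for solid and liquid;
  \<open>f_s\<close>, \<open>f_l\<close> are the solidus and liquidus curves, relevant only on \<open>[T_A, T_B]\<close>.
  The data of the boundary condition at \<open>x = 0\<close> that vary, i.e. the coefficient \<open>h\<^sub>0\<close>
  and the temperature \<open>T\<^sub>1\<close>, are passed separately.
\<close>

record alloy =
  alpha_s :: real
  alpha_l :: real
  d_s :: real
  d_l :: real
  k_s :: real
  k_l :: real
  rho :: real
  gamma :: real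
  T_A :: real
  T_B :: real
  f_s :: "real \<Rightarrow> real"
  f_l :: "real \<Rightarrow> real"
  C_0 :: real
  T_0 :: real
  T_inf :: real

definition alloy_data :: "alloy \<Rightarrow> bool" where
  "alloy_data m \<longleftrightarrow>
     0 < alpha_s m \<and> 0 < alpha_l m \<and> 0 < d_s m \<and> 0 < d_l m \<and>
     0 < k_s m \<and> 0 < k_l m \<and> 0 < rho m \<and> 0 < gamma m \<and>
     T_A m < T_B m \<and>
     continuous_on {T_A m..T_B m} (f_s m) \<and> strict_mono_on {T_A m..T_B m} (f_s m) \<and>
     continuous_on {T_A m..T_B m} (f_l m) \<and> strict_mono_on {T_A m..T_B m} (f_l m) \<and>
     f_l m (T_A m) = f_s m (T_A m) \<and> f_l m (T_B m) = f_s m (T_B m) \<and>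
     (\<forall>T. T_A m < T \<and> T < T_B m \<longrightarrow>
        f_l m (T_A m) < f_l m T \<and> f_l m T < f_s m T \<and> f_s m T < f_l m (T_B m)) \<and>
     f_l m (T_A m) < C_0 m \<and> C_0 m < f_l m (T_B m) \<and>
     T_A m < T_0 m \<and> T_0 m < T_B m \<and>
     C_0 m < f_l m (T_0 m)"

definition T_0s :: "alloy \<Rightarrow> real" where
  "T_0s m = inv_into {T_A m..T_B m} (f_s m) (C_0 m)"

definition T_0l :: "alloy \<Rightarrow> real" where
  "T_0l m = inv_into {T_A m..T_B m} (f_l m) (C_0 m)"

text \<open>\<open>\<kappa> u\<^sub>x\<^sub>x = u\<^sub>t\<close> holds classically at every point \<open>(x, t)\<close> of \<open>R\<close>.\<close>

definition diffusion_on :: "(real \<times> real) set \<Rightarrow> real \<Rightarrow> (real \<Rightarrow> real \<Rightarrow> real) \<Rightarrow> bool" where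
  "diffusion_on R \<kappa> u \<longleftrightarrow>
     (\<exists>ux uxx ut. \<forall>(x, t) \<in> R.
        ((\<lambda>y. u y t) has_real_derivative ux x t) (at x) \<and>
        ((\<lambda>y. ux y t) has_real_derivative uxx x t) (at x) \<and>
        ((\<lambda>\<tau>. u x \<tau>) has_real_derivative ut x t) (at t) \<and>
        \<kappa> * uxx x t = ut x t)"

text \<open>
  The conditions shared by the two problems, i.e. all of them except the one on the solid
  temperature at \<open>x = 0\<close>. At \<open>x = 0\<close> and at \<open>x = s(t)\<close> the space derivatives are one-sided,
  taken from within the respective phase, and the values are attained continuously. The
  initial conditions are understood as limits along the times at which \<open>(x, t)\<close> is in the
  liquid phase.
\<close>

definition solidification ::
  "alloy \<Rightarrow> (real \<Rightarrow> real) \<Rightarrow> real \<Rightarrow> (real \<Rightarrow> real \<Rightarrow> real) \<Rightarrow> (real \<Rightarrow> real \<Rightarrow> real) \<Rightarrow>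
     (real \<Rightarrow> real \<Rightarrow> real) \<Rightarrow> (real \<Rightarrow> real \<Rightarrow> real) \<Rightarrow> bool" where
  "solidification m s Tk Ts Cs Tl Cl \<longleftrightarrow>
     (\<forall>t>0. 0 < s t) \<and> T_A m < Tk \<and> Tk < T_B m \<and>
     diffusion_on {(x, t). 0 < t \<and> 0 < x \<and> x < s t} (alpha_s m) Ts \<and>
     diffusion_on {(x, t). 0 < t \<and> s t < x} (alpha_l m) Tl \<and>
     diffusion_on {(x, t). 0 < t \<and> 0 < x \<and> x < s t} (d_s m) Cs \<and>
     diffusion_on {(x, t). 0 < t \<and> s t < x} (d_l m) Cl \<and>
     (\<forall>t>0. continuous_on {0..s t} (\<lambda>x. Ts x t) \<and> continuous_on {0..s t} (\<lambda>x. Cs x t) \<and>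
            continuous_on {s t..} (\<lambda>x. Tl x t) \<and> continuous_on {s t..} (\<lambda>x. Cl x t)) \<and>
     (\<forall>t>0. Ts (s t) t = Tk \<and> Tl (s t) t = Tk) \<and>
     (\<forall>x>0. ((\<lambda>t. Tl x t) \<longlongrightarrow> T_0 m) (at 0 within {t. 0 < t \<and> s t < x})) \<and>
     (\<forall>t>0. ((\<lambda>x. Tl x t) \<longlongrightarrow> T_0 m) at_top) \<and>
     (\<forall>t>0. ((\<lambda>x. Cs x t) has_real_derivative 0) (at 0 within {0..s t})) \<and>
     (\<forall>t>0. Cs (s t) t = f_s m Tk) \<and>
     (\<forall>x>0. ((\<lambda>t. Cl x t) \<longlongrightarrow> C_0 m) (at 0 within {t. 0 < t \<and> s t < x})) \<and>
     (\<forall>t>0. Cl (s t) t = f_l m Tk) \<and>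
     (\<forall>t>0. \<exists>Tsx Tlx Csx Clx s'.
        ((\<lambda>x. Ts x t) has_real_derivative Tsx) (at (s t) within {0..s t}) \<and>
        ((\<lambda>x. Tl x t) has_real_derivative Tlx) (at (s t) within {s t..}) \<and>
        ((\<lambda>x. Cs x t) has_real_derivative Csx) (at (s t) within {0..s t}) \<and>
        ((\<lambda>x. Cl x t) has_real_derivative Clx) (at (s t) within {s t..}) \<and>
        (s has_real_derivative s') (at t) \<and>
        k_s m * Tsx - k_l m * Tlx = gamma m * rho m * s' \<and>
        d_l m * Clx - d_s m * Csx = (f_s m Tk - f_l m Tk) * s')"

definition solves_P2 ::
  "alloy \<Rightarrow> real \<Rightarrow> (real \<Rightarrow> real) \<Rightarrow> real \<Rightarrow> (real \<Rightarrow> real \<Rightarrow> real) \<Rightarrow> (real \<Rightarrow> real \<Rightarrow> real) \<Rightarrow>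
     (real \<Rightarrow> real \<Rightarrow> real) \<Rightarrow> (real \<Rightarrow> real \<Rightarrow> real) \<Rightarrow> bool" where
  "solves_P2 m h0 s Tk Ts Cs Tl Cl \<longleftrightarrow>
     solidification m s Tk Ts Cs Tl Cl \<and>
     (\<forall>t>0. \<exists>Tsx. ((\<lambda>x. Ts x t) has_real_derivative Tsx) (at 0 within {0..s t}) \<and>
        k_s m * Tsx = h0 / sqrt t * (Ts 0 t - T_inf m))"

definition solves_PR ::
  "alloy \<Rightarrow> real \<Rightarrow> (real \<Rightarrow> real) \<Rightarrow> real \<Rightarrow> (real \<Rightarrow> real \<Rightarrow> real) \<Rightarrow> (real \<Rightarrow> real \<Rightarrow> real) \<Rightarrow>
     (real \<Rightarrow> real \<Rightarrow> real) \<Rightarrow> (real \<Rightarrow> real \<Rightarrow> real) \<Rightarrow> bool" where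
  "solves_PR m T1 s Tk Ts Cs Tl Cl \<longleftrightarrow>
     solidification m s Tk Ts Cs Tl Cl \<and> (\<forall>t>0. Ts 0 t = T1)"

definition Q :: "real \<Rightarrow> real" where
  "Q x = sqrt pi * x * exp (x\<^sup>2) * erfc x"

definition Q1 :: "real \<Rightarrow> real" where
  "Q1 x = sqrt pi * x * exp (x\<^sup>2) * erf x"

definition F1 :: "real \<Rightarrow> real" where
  "F1 x = exp (x\<^sup>2) * erfc x"

definition c_ratio :: "alloy \<Rightarrow> real" where
  "c_ratio m = sqrt (alpha_s m / alpha_l m)"

definition M :: "alloy \<Rightarrow> real \<Rightarrow> real" where
  "M m x = inverse (Q (sqrt (alpha_s m / d_l m) * x))"

definition F2 :: "alloy \<Rightarrow> real \<Rightarrow> real \<Rightarrow> real" where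
  "F2 m h0 x =
     (h0 * k_s m * sqrt (pi * alpha_l m) * exp (- x\<^sup>2) * F1 (c_ratio m * x)) /
     (k_l m * (k_s m + h0 * sqrt (pi * alpha_s m) * erf x))"

definition H :: "alloy \<Rightarrow> real \<Rightarrow> real \<Rightarrow> real" where
  "H m h0 x =
     (h0 * k_s m * sqrt (pi * alpha_l m)) /
       (x * exp (x\<^sup>2) * (k_s m + h0 * sqrt (pi * alpha_s m) * erf x)) +
     (k_l m * sqrt (pi * alpha_s m)) / (sqrt (alpha_l m) * Q (c_ratio m * x))"

definition W :: "alloy \<Rightarrow> real \<Rightarrow> real \<Rightarrow> real" where
  "W m h0 x =
     T_inf m + (T_0 m - T_inf m) / (F2 m h0 x + 1) +
     (gamma m * rho m * sqrt (pi * alpha_s m * alpha_l m)) / H m h0 x"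

definition G :: "alloy \<Rightarrow> real \<Rightarrow> real \<Rightarrow> real" where
  "G m T1 x =
     (gamma m * rho m * alpha_s m * alpha_l m * Q1 x * Q (c_ratio m * x) +
      T1 * k_s m * alpha_l m * Q (c_ratio m * x) + T_0 m * k_l m * alpha_s m * Q1 x) /
     (k_s m * alpha_l m * Q (c_ratio m * x) + k_l m * alpha_s m * Q1 x)"

text \<open>Meaningful on \<open>(T_A, T_0l) \<union> (T_0l, T_B)\<close> only, hence the conditions on \<open>Tk\<close> in the two definitions below.\<close>

definition phi :: "alloy \<Rightarrow> real \<Rightarrow> real" where
  "phi m x = (f_s m x - f_l m x) / (C_0 m - f_l m x)"

definition similarity_pair :: "alloy \<Rightarrow> real \<Rightarrow> real \<Rightarrow> real \<Rightarrow> bool" where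
  "similarity_pair m h0 \<delta> Tk \<longleftrightarrow>
     0 < \<delta> \<and> T_A m < Tk \<and> Tk < T_B m \<and> Tk \<noteq> T_0l m \<and>
     Tk = W m h0 \<delta> \<and> M m \<delta> = phi m Tk"

definition rubinstein_pair :: "alloy \<Rightarrow> real \<Rightarrow> real \<Rightarrow> real \<Rightarrow> bool" where
  "rubinstein_pair m T1 \<mu> Tk \<longleftrightarrow>
     0 < \<mu> \<and> T_A m < Tk \<and> Tk < T_B m \<and> Tk \<noteq> T_0l m \<and>
     Tk = G m T1 \<mu> \<and> M m \<mu> = phi m Tk"

definition similarity_solution ::
  "alloy \<Rightarrow> real \<Rightarrow> real \<Rightarrow> (real \<Rightarrow> real) \<Rightarrow> real \<Rightarrow> (real \<Rightarrow> real \<Rightarrow> real) \<Rightarrow>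
     (real \<Rightarrow> real \<Rightarrow> real) \<Rightarrow> (real \<Rightarrow> real \<Rightarrow> real) \<Rightarrow> (real \<Rightarrow> real \<Rightarrow> real) \<Rightarrow> bool" where
  "similarity_solution m h0 \<delta> s Tk Ts Cs Tl Cl \<longleftrightarrow>
     similarity_pair m h0 \<delta> Tk \<and> solves_P2 m h0 s Tk Ts Cs Tl Cl \<and>
     (\<forall>t>0. s t = 2 * \<delta> * sqrt (alpha_s m * t)) \<and>
     (\<forall>t>0. \<forall>x\<in>{0..s t}. Ts x t =
        Tk + (h0 * sqrt (pi * alpha_s m) * (Tk - T_inf m)) /
               (k_s m + h0 * sqrt (pi * alpha_s m) * erf \<delta>) *
             (erf (x / (2 * sqrt (alpha_s m * t))) - erf \<delta>))"

definition rubinstein_solution ::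
  "alloy \<Rightarrow> real \<Rightarrow> real \<Rightarrow> (real \<Rightarrow> real) \<Rightarrow> real \<Rightarrow> (real \<Rightarrow> real \<Rightarrow> real) \<Rightarrow>
     (real \<Rightarrow> real \<Rightarrow> real) \<Rightarrow> (real \<Rightarrow> real \<Rightarrow> real) \<Rightarrow> (real \<Rightarrow> real \<Rightarrow> real) \<Rightarrow> bool" where
  "rubinstein_solution m T1 \<mu> s Tk Ts Cs Tl Cl \<longleftrightarrow>
     rubinstein_pair m T1 \<mu> Tk \<and> solves_PR m T1 s Tk Ts Cs Tl Cl \<and>
     (\<forall>t>0. s t = 2 * \<mu> * sqrt (alpha_s m * t)) \<and>
     (\<forall>t>0. \<forall>x\<in>{0..s t}. Ts x t =
        T1 + (Tk - T1) / erf \<mu> * erf (x / (2 * sqrt (alpha_s m * t))))"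

end

theory Submission
  imports Defs "HOL-Probability.Distributions" "HOL-Real_Asymp.Real_Asymp"
begin

text \<open>
  With the face temperature of the similarity solution prescribed as Dirichlet datum \<open>T\<^sub>1\<close>, the
  similarity solution of the convective problem should also solve the Dirichlet problem. On the
  level of the determining equations this says that a pair with \<open>T = W \<delta>\<close> also satisfies \<open>T = G \<delta>\<close>, which
  is the energy balance at the free boundary written in two ways
  (\<open>similarity_pair_is_rubinstein_pair\<close>).

  The Rubinstein pair is unique (\<open>rubinstein_pair_unique\<close>). Indeed \<open>M\<close> is decreasing with values
  above \<open>1\<close>, which forces the temperature into the interval from \<open>T\<^sub>0\<^sub>s\<close> to \<open>T\<^sub>0\<^sub>l\<close> on which \<open>\<phi>\<close>
  increases. So \<open>M x = \<phi> T\<close> makes \<open>T\<close> decrease with \<open>x\<close>, while \<open>T = G x\<close> makes it increase, as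
  long as \<open>T\<^sub>1 \<le> T\<^sub>0\<close>; two such curves meet at most once. The monotonicity of \<open>M\<close> and \<open>G\<close> rests on
  the two classical bounds for the Mills ratio of the Gaussian (\<open>erfc_lower_bound\<close>,
  \<open>erfc_upper_bound\<close>).

  Hence \<open>\<mu> = \<delta>\<close>, and both solidification temperatures agree with a common value \<open>T\<close>. The
  definition of \<open>T\<^sub>1\<close> gives
  \<open>(T - T\<^sub>1) / (T\<^sub>1 - T\<^sub>\<infinity>) = h\<^sub>0 sqrt (\<pi> \<alpha>\<^sub>s) erf \<delta> / k\<^sub>s\<close>, so that each of the claimed bounds is
  \<open>erf \<delta>\<close> times a factor, and the two bounds on \<open>h\<^sub>0\<close> say that these factors lie on the two sides
  of \<open>1\<close>.
\<close>

section \<open>The error function\<close>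

lemma has_real_derivative_erf:
  "(erf has_real_derivative 2 / sqrt pi * exp (- x\<^sup>2)) (at x)"
proof -
  let ?b = "\<bar>x\<bar> + 1"
  have "((\<lambda>u. LBINT t=ereal 0..ereal u. exp (- t\<^sup>2)) has_vector_derivative exp (- x\<^sup>2))
          (at x within {-?b..?b})"
    by (rule interval_integral_FTC2) (auto intro!: continuous_intros)
  moreover have "at x within {-?b..?b} = at x"
    by (rule at_within_interior) auto
  ultimately have "((\<lambda>u. LBINT t=0..ereal u. exp (- t\<^sup>2)) has_real_derivative exp (- x\<^sup>2)) (at x)"
    by (simp add: has_real_derivative_iff_has_vector_derivative zero_ereal_def)
  from DERIV_cmult[OF this, of "2 / sqrt pi"] show ?thesis
    by (simp add: erf_def[abs_def])
qed

lemma has_real_derivative_erfc: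
  "(erfc has_real_derivative - (2 / sqrt pi * exp (- x\<^sup>2))) (at x)"
  using DERIV_diff[OF DERIV_const has_real_derivative_erf, of 1 x]
  by (simp add: erfc_def[abs_def])

lemma strict_mono_erf: "strict_mono erf"
proof (rule strict_monoI)
  fix x y :: real assume "x < y"
  then show "erf x < erf y"
    by (rule DERIV_pos_imp_increasing) (auto intro!: exI has_real_derivative_erf)
qed

lemma erf_pos: "0 < x \<Longrightarrow> 0 < erf x"
  using strict_monoD[OF strict_mono_erf, of 0 x] by (simp add: erf_def zero_ereal_def[symmetric])

lemma tendsto_erf_at_top: "(erf \<longlongrightarrow> 1) at_top"
proof -
  let ?g = "\<lambda>t::real. exp (- t\<^sup>2)"
  have int: "set_integrable lborel {0..} ?g" and val: "(LBINT t:{0..}. ?g t) = sqrt pi / 2"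
    using gaussian_moment_0
    by (auto simp: set_integrable_def set_lebesgue_integral_def has_bochner_integral_iff)
  have "((\<lambda>x. LBINT t:{0..x}. ?g t) \<longlongrightarrow> sqrt pi / 2) at_top"
    using tendsto_set_lebesgue_integral_at_top[OF _ int] val by simp
  then have "((\<lambda>x. 2 / sqrt pi * (LBINT t:{0..x}. ?g t)) \<longlongrightarrow> 2 / sqrt pi * (sqrt pi / 2)) at_top"
    by (intro tendsto_mult tendsto_const)
  moreover have "\<forall>\<^sub>F x in at_top. 2 / sqrt pi * (LBINT t:{0..x}. ?g t) = erf x"
    using eventually_ge_at_top[of 0]
    by eventually_elim (simp add: erf_def interval_integral_Icc zero_ereal_def)
  ultimately show ?thesis
    using tendsto_cong by (fastforce simp: field_simps)
qed

lemma tendsto_erfc_at_top: "(erfc \<longlongrightarrow> 0) at_top"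
  using tendsto_diff[OF tendsto_const tendsto_erf_at_top, of 1] by (simp add: erfc_def[abs_def])

lemma erfc_pos: "0 < erfc x"
  by (rule DERIV_neg_imp_decreasing_at_top[OF _ tendsto_erfc_at_top])
     (auto intro!: exI conjI has_real_derivative_erfc)

text \<open>
  The difference of the two sides vanishes at infinity and has derivative
  \<open>- exp (- x\<^sup>2) / (sqrt \<pi> x\<^sup>2) < 0\<close>, hence is positive.
\<close>

lemma erfc_upper_bound:
  assumes "0 < x"
  shows "erfc x < exp (- x\<^sup>2) / (sqrt pi * x)"
proof -
  let ?D = "\<lambda>x. exp (- x\<^sup>2) / (sqrt pi * x) - erfc x"
  have "0 < ?D x"
  proof (rule DERIV_neg_imp_decreasing_at_top[where f = ?D and b = x])
    fix y assume "x \<le> y"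
    with assms have y: "0 < y" by simp
    have "(?D has_real_derivative - (exp (- y\<^sup>2) / (sqrt pi * y\<^sup>2))) (at y)"
      using y
      by (auto intro!: derivative_eq_intros has_real_derivative_erfc)
        (simp add: divide_simps, simp add: algebra_simps power2_eq_square)
    then show "\<exists>d. (?D has_real_derivative d) (at y) \<and> d < 0"
      using y by (intro exI conjI) auto
  next
    have "((\<lambda>x. exp (- x\<^sup>2) / (sqrt pi * x)) \<longlongrightarrow> 0) at_top" by real_asymp
    from tendsto_diff[OF this tendsto_erfc_at_top] show "(?D \<longlongrightarrow> 0) at_top" by simp
  qed
  then show ?thesis by simp
qed

text \<open>
  The fraction is the next convergent of the continued fraction of the Mills ratio. Again the
  difference of the two sides vanishes at infinity and is decreasing. This bound is sharp enough
  to give the sign of the derivative of \<open>Q\<close>.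
\<close>

lemma erfc_lower_bound: "2 * x * exp (- x\<^sup>2) / (sqrt pi * (1 + 2 * x\<^sup>2)) < erfc x"
proof -
  let ?D = "\<lambda>x. erfc x - 2 * x * exp (- x\<^sup>2) / (sqrt pi * (1 + 2 * x\<^sup>2))"
  have "0 < ?D x"
  proof (rule DERIV_neg_imp_decreasing_at_top[where f = ?D and b = x])
    fix y :: real
    have nz: "1 + 2 * y\<^sup>2 > 0" by (simp add: add_pos_nonneg)
    have "(?D has_real_derivative - (4 * exp (- y\<^sup>2) / (sqrt pi * (1 + 2 * y\<^sup>2)\<^sup>2))) (at y)"
      using nz
      by (auto intro!: derivative_eq_intros has_real_derivative_erfc)
        (simp add: divide_simps, auto simp: algebra_simps power2_eq_square)
    then show "\<exists>d. (?D has_real_derivative d) (at y) \<and> d < 0"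
      using nz by (intro exI conjI) auto
  next
    have "((\<lambda>x. 2 * x * exp (- x\<^sup>2) / (sqrt pi * (1 + 2 * x\<^sup>2))) \<longlongrightarrow> 0) at_top" by real_asymp
    from tendsto_diff[OF tendsto_erfc_at_top this] show "(?D \<longlongrightarrow> 0) at_top" by simp
  qed
  then show ?thesis by simp
qed

section \<open>Monotonicity of the auxiliary functions\<close>

lemma Q_pos: "0 < x \<Longrightarrow> 0 < Q x"
  by (simp add: Q_def erfc_pos)

lemma Q_less_1: "0 < x \<Longrightarrow> Q x < 1"
  using erfc_upper_bound[of x] by (simp add: Q_def exp_minus field_simps)

text \<open>
  The product rule gives \<open>sqrt \<pi> (1 + 2 x\<^sup>2) exp (x\<^sup>2) erfc x - 2 x\<close> as the derivative, and its
  positivity is the lower bound for \<open>erfc\<close>.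
\<close>

lemma strict_mono_on_Q: "strict_mono_on {0<..} Q"
proof (rule strict_mono_onI)
  fix x y :: real assume x: "x \<in> {0<..}" and xy: "x < y"
  show "Q x < Q y"
  proof (rule DERIV_pos_imp_increasing[OF xy])
    fix z assume "x \<le> z"
    with x have z: "0 < z" by simp
    have "(Q has_real_derivative sqrt pi * (1 + 2 * z\<^sup>2) * exp (z\<^sup>2) * erfc z - 2 * z) (at z)"
      unfolding Q_def[abs_def]
      by (auto intro!: derivative_eq_intros has_real_derivative_erfc
          simp: exp_minus field_simps power2_eq_square)
    moreover have "2 * z < sqrt pi * (1 + 2 * z\<^sup>2) * exp (z\<^sup>2) * erfc z"
      using erfc_lower_bound[of z] by (simp add: exp_minus field_simps add_pos_nonneg)
    ultimately show "\<exists>d. (Q has_real_derivative d) (at z) \<and> 0 < d"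
      by (intro exI conjI) auto
  qed
qed

lemma F1_pos: "0 < F1 x"
  by (simp add: F1_def erfc_pos)

text \<open>
  The derivative is a positive multiple of \<open>Q - 1\<close>, so it is negative by the upper bound for
  \<open>erfc\<close>.
\<close>

lemma F1_decreasing:
  assumes "0 < x" "x < y"
  shows "F1 y < F1 x"
proof (rule DERIV_neg_imp_decreasing[OF assms(2)])
  fix z assume "x \<le> z"
  with assms have z: "0 < z" by simp
  have "(F1 has_real_derivative 2 / sqrt pi * (Q z - 1)) (at z)"
    unfolding F1_def[abs_def] Q_def
    by (auto intro!: derivative_eq_intros has_real_derivative_erfc
        simp: exp_minus field_simps power2_eq_square)
  moreover have "2 / sqrt pi * (Q z - 1) < 0"
    using Q_less_1[OF z] by (intro mult_pos_neg) auto
  ultimately show "\<exists>d. (F1 has_real_derivative d) (at z) \<and> d < 0"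
    by blast
qed

lemma Q_eq_F1: "Q x = sqrt pi * x * F1 x"
  by (simp add: Q_def F1_def)

lemma Q1_pos: "0 < x \<Longrightarrow> 0 < Q1 x"
  by (simp add: Q1_def erf_pos)

text \<open>
  The two linear factors cancel, which leaves \<open>c F\<^sub>1(c x)\<close>, a decreasing function, divided by
  \<open>exp (x\<^sup>2) erf x\<close>, an increasing one.
\<close>

lemma Q_over_Q1_decreasing:
  assumes "0 < c" "0 < x" "x < y"
  shows "Q (c * y) / Q1 y < Q (c * x) / Q1 x"
proof -
  have eq: "Q (c * z) / Q1 z = c * F1 (c * z) / (exp (z\<^sup>2) * erf z)" if "0 < z" for z
    using that by (simp add: Q_eq_F1 Q1_def)
  have "exp (x\<^sup>2) * erf x < exp (y\<^sup>2) * erf y"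
    using assms strict_monoD[OF strict_mono_erf, of x y] erf_pos[of x]
    by (intro mult_strict_mono) (auto intro: power_strict_mono)
  then show ?thesis
    unfolding eq[OF \<open>0 < x\<close>] eq[OF order.strict_trans[OF \<open>0 < x\<close> \<open>x < y\<close>]]
    using assms F1_decreasing[of "c * x" "c * y"] F1_pos[of "c * y"] erf_pos[of x]
    by (intro frac_less) (auto intro!: mult_pos_pos less_imp_le)
qed

section \<open>The liquidus and solidus temperatures\<close>

lemma
  assumes "alloy_data m"
  shows T_0l_mem: "T_0l m \<in> {T_A m..T_B m}" and f_l_T_0l: "f_l m (T_0l m) = C_0 m"
    and T_0s_mem: "T_0s m \<in> {T_A m..T_B m}" and f_s_T_0s: "f_s m (T_0s m) = C_0 m"
proof -
  note a = assms[unfolded alloy_data_def]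
  have "C_0 m \<in> f_l m ` {T_A m..T_B m}"
    using IVT'[of "f_l m" "T_A m" "C_0 m" "T_B m"] a by force
  then show "T_0l m \<in> {T_A m..T_B m}" "f_l m (T_0l m) = C_0 m"
    unfolding T_0l_def by (rule inv_into_into, rule f_inv_into_f)
  have "C_0 m \<in> f_s m ` {T_A m..T_B m}"
    using IVT'[of "f_s m" "T_A m" "C_0 m" "T_B m"] a by force
  then show "T_0s m \<in> {T_A m..T_B m}" "f_s m (T_0s m) = C_0 m"
    unfolding T_0s_def by (rule inv_into_into, rule f_inv_into_f)
qed

lemma T_0l_less_T_0:
  assumes "alloy_data m"
  shows "T_0l m < T_0 m"
proof (rule ccontr)
  assume "\<not> T_0l m < T_0 m"
  then have "f_l m (T_0 m) \<le> f_l m (T_0l m)"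
    using assms T_0l_mem[OF assms]
    by (auto simp: alloy_data_def intro: strict_mono_on_leD)
  with assms f_l_T_0l[OF assms] show False by (simp add: alloy_data_def)
qed

text \<open>
  The solidus lies strictly above the liquidus inside the temperature range, so it reaches the
  level \<open>C\<^sub>0\<close> first.
\<close>

lemma T_0s_less_T_0l:
  assumes "alloy_data m"
  shows "T_0s m < T_0l m"
proof (rule ccontr)
  assume "\<not> T_0s m < T_0l m"
  then have le: "f_s m (T_0l m) \<le> f_s m (T_0s m)"
    using assms T_0l_mem[OF assms] T_0s_mem[OF assms]
    by (auto simp: alloy_data_def intro: strict_mono_on_leD)
  have "T_0l m \<noteq> T_A m" "T_0l m \<noteq> T_B m"
    using assms f_l_T_0l[OF assms] by (auto simp: alloy_data_def)
  then have "f_l m (T_0l m) < f_s m (T_0l m)"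
    using assms T_0l_mem[OF assms] by (auto simp: alloy_data_def)
  with le f_l_T_0l[OF assms] f_s_T_0s[OF assms] show False by simp
qed

text \<open>
  Above \<open>T\<^sub>0\<^sub>l\<close> the denominator of \<open>\<phi>\<close> has changed sign. Since \<open>M\<close> is positive, this excludes
  solidification temperatures beyond \<open>T\<^sub>0\<^sub>l\<close>.
\<close>

lemma phi_neg:
  assumes "alloy_data m" "T_0l m < T" "T < T_B m"
  shows "phi m T < 0"
proof -
  have T: "T_A m < T" using T_0l_mem[OF assms(1)] assms by simp
  have "f_l m (T_0l m) < f_l m T"
    using assms T T_0l_mem[OF assms(1)]
    by (intro strict_mono_onD[of "{T_A m..T_B m}" "f_l m"]) (auto simp: alloy_data_def)
  moreover have "f_l m T < f_s m T"
    using assms T by (auto simp: alloy_data_def)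
  ultimately show ?thesis
    by (auto simp: phi_def f_l_T_0l[OF assms(1)] divide_pos_neg)
qed

lemma phi_eq:
  assumes "f_l m T \<noteq> C_0 m"
  shows "phi m T = 1 + (f_s m T - C_0 m) / (C_0 m - f_l m T)"
  using assms by (simp add: phi_def field_simps)

text \<open>
  In \<open>\<phi> = 1 + (f\<^sub>s - C\<^sub>0) / (C\<^sub>0 - f\<^sub>l)\<close> the numerator increases and the denominator decreases. For
  the quotient to increase, the numerator should also be positive, and \<open>1 < \<phi> T\<close> guarantees this.
  Values of \<open>M\<close> satisfy the latter inequality.
\<close>

lemma phi_mono:
  assumes "alloy_data m" "T_A m < T" "T \<le> T'" "T' < T_0l m" "1 < phi m T"
  shows "phi m T \<le> phi m T'"
proof -
  have fl: "f_l m U < f_l m V" "f_s m U < f_s m V"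
    if "U < V" "U \<in> {T_A m..T_B m}" "V \<in> {T_A m..T_B m}" for U V
    using that assms(1) by (auto simp: alloy_data_def intro: strict_mono_onD)
  have mem: "T_A m \<le> T" "T \<le> T_B m" "T_A m \<le> T'" "T' \<le> T_B m"
    using assms T_0l_mem[OF assms(1)] by auto
  have l': "f_l m T' < C_0 m"
    using fl(1)[OF \<open>T' < T_0l m\<close>] mem T_0l_mem[OF assms(1)] f_l_T_0l[OF assms(1)] by simp
  have ll: "f_l m T \<le> f_l m T'" and ss: "f_s m T \<le> f_s m T'"
    using fl[of T T'] mem \<open>T \<le> T'\<close> by (cases "T = T'"; simp)+
  have "0 < (f_s m T - C_0 m) / (C_0 m - f_l m T)"
    using assms(5) phi_eq[of m T] ll l' by auto
  then have "C_0 m < f_s m T" using ll l' by (simp add: zero_less_divide_iff)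
  then show ?thesis
    using ll l' ss phi_eq[of m T] phi_eq[of m T'] by (auto intro!: frac_le)
qed

section \<open>Uniqueness of the Rubinstein pair\<close>

lemma M_gt_1:
  assumes "alloy_data m" "0 < x"
  shows "1 < M m x"
proof -
  have k: "0 < sqrt (alpha_s m / d_l m) * x"
    using assms by (simp add: alloy_data_def)
  show ?thesis
    using Q_pos[OF k] Q_less_1[OF k] by (simp add: M_def one_less_inverse)
qed

lemma M_decreasing:
  assumes "alloy_data m" "0 < x" "x < y"
  shows "M m y < M m x"
proof -
  have k: "0 < sqrt (alpha_s m / d_l m)"
    using assms by (simp add: alloy_data_def)
  then have "Q (sqrt (alpha_s m / d_l m) * x) < Q (sqrt (alpha_s m / d_l m) * y)"
    using assms by (intro strict_mono_onD[OF strict_mono_on_Q]) auto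
  then show ?thesis
    using Q_pos[of "sqrt (alpha_s m / d_l m) * x"] k assms by (simp add: M_def)
qed

lemma c_ratio_pos: "alloy_data m \<Longrightarrow> 0 < c_ratio m"
  by (simp add: c_ratio_def alloy_data_def)

text \<open>
  Dividing numerator and denominator by \<open>Q\<^sub>1\<close> separates the monotone parts: only the increasing
  \<open>Q\<close> remains in the numerator, and only the decreasing quotient \<open>Q / Q\<^sub>1\<close> in the denominator.
\<close>

lemma G_eq:
  assumes "alloy_data m" "0 < x"
  shows "G m T1 x = T1 +
    (k_l m * alpha_s m * (T_0 m - T1) + gamma m * rho m * alpha_s m * alpha_l m * Q (c_ratio m * x)) /
    (k_l m * alpha_s m + k_s m * alpha_l m * (Q (c_ratio m * x) / Q1 x))"
proof -
  have eq: "(g * u * v + T * p * v + S * q * u) / (p * v + q * u) = T + (q * (S - T) + g * v) / (q + p * (v / u))"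
    if "0 < p" "0 < q" "0 < u" "0 < v" for p q u v g S T :: real
  proof -
    have d: "0 < p * v + q * u" using that by (simp add: add_pos_pos)
    have "q + p * (v / u) = (p * v + q * u) / u" using that by (simp add: field_simps)
    then show ?thesis using that d by (simp add: field_simps)
  qed
  have c: "0 < c_ratio m * x" using c_ratio_pos assms by simp
  show ?thesis
    using eq[of "k_s m * alpha_l m" "k_l m * alpha_s m" "Q1 x" "Q (c_ratio m * x)"
        "gamma m * rho m * alpha_s m * alpha_l m" T1 "T_0 m"] assms Q1_pos[of x] Q_pos[OF c]
    by (simp add: G_def alloy_data_def mult.assoc)
qed

lemma G_increasing:
  assumes a: "alloy_data m" and "T1 \<le> T_0 m" "0 < x" "x < y"
  shows "G m T1 x < G m T1 y"
proof -
  note c = c_ratio_pos[OF a]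
  have pos: "0 < k_l m * alpha_s m" "0 < k_s m * alpha_l m" "0 < gamma m * rho m * alpha_s m * alpha_l m"
    using a by (auto simp: alloy_data_def)
  have Qless: "Q (c_ratio m * x) < Q (c_ratio m * y)"
    using c assms by (intro strict_mono_onD[OF strict_mono_on_Q]) auto
  have Qpos: "0 < Q (c_ratio m * x)" "0 < Q1 y" "0 < Q (c_ratio m * y)"
    using c assms by (auto intro: Q_pos Q1_pos)
  have num: "k_l m * alpha_s m * (T_0 m - T1) + gamma m * rho m * alpha_s m * alpha_l m * Q (c_ratio m * x)
      < k_l m * alpha_s m * (T_0 m - T1) + gamma m * rho m * alpha_s m * alpha_l m * Q (c_ratio m * y)"
    using mult_strict_left_mono[OF Qless pos(3)] by simp
  have num_nonneg: "0 \<le> k_l m * alpha_s m * (T_0 m - T1) + gamma m * rho m * alpha_s m * alpha_l m * Q (c_ratio m * x)"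
    using a Qpos \<open>T1 \<le> T_0 m\<close> by (auto simp: alloy_data_def)
  have den: "k_l m * alpha_s m + k_s m * alpha_l m * (Q (c_ratio m * y) / Q1 y)
      \<le> k_l m * alpha_s m + k_s m * alpha_l m * (Q (c_ratio m * x) / Q1 x)"
    using mult_strict_left_mono[OF Q_over_Q1_decreasing[OF c \<open>0 < x\<close> \<open>x < y\<close>] pos(2)] by simp
  have den_pos: "0 < k_l m * alpha_s m + k_s m * alpha_l m * (Q (c_ratio m * y) / Q1 y)"
    by (intro add_pos_pos pos(1) mult_pos_pos[OF pos(2)] divide_pos_pos Qpos)
  have y: "0 < y" using \<open>0 < x\<close> \<open>x < y\<close> by simp
  show ?thesis
    unfolding G_eq[OF a \<open>0 < x\<close>] G_eq[OF a y]
    by (intro add_strict_left_mono frac_less num_nonneg num den_pos den)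
qed

lemma pair_below_T_0l:
  assumes "alloy_data m" "0 < x" "T \<noteq> T_0l m" "T < T_B m" "M m x = phi m T"
  shows "T < T_0l m"
  using phi_neg[of m T] M_gt_1[of m x] assms by force

text \<open>
  If \<open>x < x'\<close>, then \<open>T < T'\<close> because \<open>G\<close> increases, and so
  \<open>M x = \<phi> T \<le> \<phi> T' = M x'\<close>, although \<open>M\<close> decreases.
\<close>

lemma rubinstein_pair_unique:
  assumes a: "alloy_data m" and "T1 \<le> T_0 m"
    and p: "rubinstein_pair m T1 x T" "rubinstein_pair m T1 x' T'"
  shows "x = x' \<and> T = T'"
proof -
  have no_less: False
    if p: "rubinstein_pair m T1 x T" "rubinstein_pair m T1 x' T'" and "x < x'" for x x' T T'
  proof -
    note p = p[unfolded rubinstein_pair_def]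
    have "T < T'" using G_increasing[OF assms(1,2), of x x'] p \<open>x < x'\<close> by simp
    moreover have "T' < T_0l m" using pair_below_T_0l[OF a] p by blast
    moreover have "1 < phi m T" using M_gt_1[OF a, of x] p by simp
    ultimately have "phi m T \<le> phi m T'" using phi_mono[OF a] p by simp
    with M_decreasing[OF a, of x x'] p \<open>x < x'\<close> show False by simp
  qed
  have "x = x'" using no_less p by (metis linorder_neqE_linordered_idom)
  with p show ?thesis by (simp add: rubinstein_pair_def)
qed

section \<open>From the convective to the Dirichlet condition\<close>

text \<open>
  With this form, the term of \<open>W\<close> that contains \<open>H\<close> gets the same denominator \<open>F\<^sub>2 + 1\<close> as the
  other one.
\<close>

lemma H_eq:
  assumes "alloy_data m" "0 < x" "0 < h0"
  shows "H m h0 x = k_l m * (F2 m h0 x + 1) / (x * F1 (c_ratio m * x))"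
proof -
  have P: "k_s m + h0 * sqrt (pi * alpha_s m) * erf x > 0"
    using assms erf_pos[of x] by (simp add: alloy_data_def add_pos_pos)
  have "k_l m * sqrt (pi * alpha_s m) / (sqrt (alpha_l m) * Q (c_ratio m * x)) = k_l m / (x * F1 (c_ratio m * x))"
    using assms F1_pos[of "c_ratio m * x"]
    by (simp add: Q_eq_F1 alloy_data_def c_ratio_def real_sqrt_mult real_sqrt_divide)
  moreover have "h0 * k_s m * sqrt (pi * alpha_l m) / (x * exp (x\<^sup>2) * (k_s m + h0 * sqrt (pi * alpha_s m) * erf x))
      = k_l m * F2 m h0 x / (x * F1 (c_ratio m * x))"
  proof -
    have "a / (x * E * P) = k * ((a * (1 / E) * F) / (k * P)) / (x * F)"
      if "E \<noteq> 0" "k \<noteq> 0" "P \<noteq> 0" "F \<noteq> 0" for a E P k F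
      using that \<open>0 < x\<close> by simp
    from this[of "exp (x\<^sup>2)" "k_l m" "k_s m + h0 * sqrt (pi * alpha_s m) * erf x" "F1 (c_ratio m * x)"
        "h0 * k_s m * sqrt (pi * alpha_l m)"]
    show ?thesis
      using P F1_pos[of "c_ratio m * x"] assms(1)
      by (simp add: F2_def exp_minus inverse_eq_divide alloy_data_def)
  qed
  ultimately show ?thesis
    by (simp add: H_def add_divide_distrib distrib_left)
qed

lemma F2_pos:
  assumes "alloy_data m" "0 < x" "0 < h0"
  shows "0 < F2 m h0 x"
  using assms F1_pos[of "c_ratio m * x"] erf_pos[of x]
  by (simp add: F2_def alloy_data_def add_pos_pos)

text \<open>
  This is \<open>T = W x\<close> cleared of denominators. Up to a common factor it is the energy balance at the
  free boundary: the heat conducted away into the solid on the left; the heat arriving from the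
  liquid and the latent heat on the right.
\<close>

lemma W_balance:
  assumes "alloy_data m" "0 < x" "0 < h0"
  shows "F2 m h0 x * (W m h0 x - T_inf m) = T_0 m - W m h0 x +
    gamma m * rho m * sqrt (pi * alpha_s m * alpha_l m) * x * F1 (c_ratio m * x) / k_l m"
proof -
  note f = F2_pos[OF assms]
  have "gamma m * rho m * sqrt (pi * alpha_s m * alpha_l m) / H m h0 x =
    (gamma m * rho m * sqrt (pi * alpha_s m * alpha_l m) * x * F1 (c_ratio m * x) / k_l m) / (F2 m h0 x + 1)"
    unfolding H_eq[OF assms] by (simp add: mult_ac)
  then have "W m h0 x = T_inf m + (T_0 m - T_inf m +
     gamma m * rho m * sqrt (pi * alpha_s m * alpha_l m) * x * F1 (c_ratio m * x) / k_l m) / (F2 m h0 x + 1)"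
    unfolding W_def by (simp add: add_divide_distrib)
  moreover have "f * (T + N / (f + 1) - T) = S - (T + N / (f + 1)) + g"
    if "0 < f" "N = S - T + g" for f N S T g :: real
  proof -
    define w where "w = N / (f + 1)"
    have "w * (f + 1) = S - T + g" using that by (simp add: w_def)
    then show ?thesis unfolding w_def[symmetric] by (simp add: algebra_simps)
  qed
  ultimately show ?thesis using f by presburger
qed

lemma W_gt_T_inf:
  assumes "alloy_data m" "0 < x" "0 < h0" "T_inf m < T_0 m"
  shows "T_inf m < W m h0 x"
proof -
  have "0 < H m h0 x"
    unfolding H_eq[OF assms(1-3)]
    using assms F2_pos[OF assms(1-3)] F1_pos[of "c_ratio m * x"]
    by (intro divide_pos_pos mult_pos_pos) (auto simp: alloy_data_def)
  then have "0 < gamma m * rho m * sqrt (pi * alpha_s m * alpha_l m) / H m h0 x"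
    using assms(1) by (simp add: alloy_data_def)
  moreover have "0 < (T_0 m - T_inf m) / (F2 m h0 x + 1)"
    using assms(4) F2_pos[OF assms(1-3)] by simp
  ultimately show ?thesis unfolding W_def by linarith
qed

text \<open>
  The value at \<open>x = 0\<close> of the solid temperature of the similarity solution with solidification
  temperature \<open>T\<close>.
\<close>

definition face_temperature :: "alloy \<Rightarrow> real \<Rightarrow> real \<Rightarrow> real \<Rightarrow> real" where
  "face_temperature m h0 \<delta> T = T - (h0 * sqrt (pi * alpha_s m) * erf \<delta> * (T - T_inf m)) /
                         (k_s m + h0 * sqrt (pi * alpha_s m) * erf \<delta>)"

lemma face_temperature_minus_T_inf:
  assumes "alloy_data m" "0 < \<delta>" "0 < h0"
  shows "face_temperature m h0 \<delta> T - T_inf m =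
    k_s m * (T - T_inf m) / (k_s m + h0 * sqrt (pi * alpha_s m) * erf \<delta>)"
proof -
  have "k_s m + h0 * sqrt (pi * alpha_s m) * erf \<delta> > 0"
    using assms erf_pos[of \<delta>] by (simp add: alloy_data_def add_pos_pos)
  then show ?thesis by (simp add: face_temperature_def field_simps)
qed

text \<open>
  In \<open>T = G \<delta>\<close>, cleared of denominators, \<open>T\<close> enters through \<open>T - T\<^sub>1\<close> and \<open>T\<^sub>0 - T\<close>. Since
  \<open>T - T\<^sub>1\<close> is proportional to \<open>T - T\<^sub>\<infinity>\<close> when \<open>T\<^sub>1\<close> is the face temperature, this becomes
  \<open>W_balance\<close> multiplied by \<open>k\<^sub>l \<alpha>\<^sub>s Q\<^sub>1 \<delta>\<close>.
\<close>

lemma similarity_pair_is_rubinstein_pair: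
  assumes a: "alloy_data m" and h: "0 < h0" and p: "similarity_pair m h0 \<delta> T"
  shows "rubinstein_pair m (face_temperature m h0 \<delta> T) \<delta> T"
proof -
  have d: "0 < \<delta>" and T: "T = W m h0 \<delta>" using p by (auto simp: similarity_pair_def)
  note pos = a[unfolded alloy_data_def]
  define u where "u = Q1 \<delta>"
  define v where "v = Q (c_ratio m * \<delta>)"
  define E where "E = k_s m * alpha_l m * v + k_l m * alpha_s m * u"
  have u: "0 < u" and v: "0 < v" using d c_ratio_pos[OF a] by (auto simp: u_def v_def Q1_pos Q_pos)
  have E: "0 < E" using u v pos by (simp add: E_def add_pos_pos)
  have P: "k_s m + h0 * sqrt (pi * alpha_s m) * erf \<delta> > 0"
    using pos h erf_pos[OF d] by (simp add: add_pos_pos)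
  have sq: "sqrt (alpha_s m) * sqrt (alpha_s m) = alpha_s m"
    using pos by auto
  have v_eq: "alpha_l m * v = sqrt (pi * alpha_s m * alpha_l m) * \<delta> * F1 (c_ratio m * \<delta>)"
    using pos by (simp add: v_def Q_eq_F1 c_ratio_def real_sqrt_mult real_sqrt_divide field_simps)
  have F2_eq: "F2 m h0 \<delta> * (k_l m * alpha_s m * u) =
      k_s m * alpha_l m * v * (h0 * sqrt (pi * alpha_s m) * erf \<delta>) / (k_s m + h0 * sqrt (pi * alpha_s m) * erf \<delta>)"
  proof -
    define P r F where "P = k_s m + h0 * sqrt (pi * alpha_s m) * erf \<delta>"
      and "r = sqrt (alpha_s m)" and "F = F1 (c_ratio m * \<delta>)"
    have "F2 m h0 \<delta> = h0 * k_s m * (sqrt pi * sqrt (alpha_l m)) * F / (exp (\<delta>\<^sup>2) * k_l m * P)"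
      by (simp add: F2_def P_def F_def exp_minus real_sqrt_mult inverse_eq_divide)
    moreover have "k_l m * alpha_s m * u = k_l m * (r * r) * (sqrt pi * \<delta> * exp (\<delta>\<^sup>2) * erf \<delta>)"
      unfolding u_def Q1_def r_def sq ..
    moreover have "k_s m * alpha_l m * v = k_s m * (sqrt pi * r * sqrt (alpha_l m) * \<delta> * F)"
      unfolding mult.assoc[of "k_s m" "alpha_l m" v] v_eq r_def F_def real_sqrt_mult ..
    moreover have "sqrt (pi * alpha_s m) = sqrt pi * r"
      unfolding r_def real_sqrt_mult ..
    moreover have "P \<noteq> 0" "k_l m \<noteq> 0"
      using pos P by (auto simp: P_def)
    ultimately show ?thesis
      unfolding P_def[symmetric] by (simp only:) (simp add: divide_simps)
  qed
  have balance: "F2 m h0 \<delta> * (T - T_inf m) = T_0 m - T + gamma m * rho m * (alpha_l m * v) / k_l m"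
    using W_balance[OF a d h, folded T] unfolding v_eq by (simp only: mult.assoc)
  have "(T - face_temperature m h0 \<delta> T) * (k_s m * alpha_l m * v) =
      k_s m * alpha_l m * v * (h0 * sqrt (pi * alpha_s m) * erf \<delta>) /
        (k_s m + h0 * sqrt (pi * alpha_s m) * erf \<delta>) * (T - T_inf m)"
    unfolding face_temperature_def by simp
  also have "\<dots> = F2 m h0 \<delta> * (T - T_inf m) * (k_l m * alpha_s m * u)"
    unfolding F2_eq[symmetric] by (simp only: mult_ac)
  also have "\<dots> = (T_0 m - T + gamma m * rho m * (alpha_l m * v) / k_l m) * (k_l m * alpha_s m * u)"
    by (simp only: balance)
  also have "\<dots> = (T_0 m - T) * (k_l m * alpha_s m * u) + gamma m * rho m * alpha_s m * alpha_l m * u * v"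
    using pos by (simp add: distrib_right)
  finally have "T * E = gamma m * rho m * alpha_s m * alpha_l m * u * v + face_temperature m h0 \<delta> T * k_s m * alpha_l m * v
      + T_0 m * k_l m * alpha_s m * u"
    by (simp add: E_def algebra_simps)
  then have "T = G m (face_temperature m h0 \<delta> T) \<delta>"
    using E unfolding G_def u_def[symmetric] v_def[symmetric] E_def[symmetric]
    by (simp add: eq_divide_eq)
  then show ?thesis
    using p by (simp add: rubinstein_pair_def similarity_pair_def)
qed

section \<open>Bounds for the free boundary coefficient\<close>

theorem corollary5p2:
  fixes m :: alloy
    and h0 T1 \<delta> \<mu> Tk_hat Tk_tilde :: real
    and s_hat s_tilde :: "real \<Rightarrow> real"
    and Ts_hat Cs_hat Tl_hat Cl_hat :: "real \<Rightarrow> real \<Rightarrow> real"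
    and Ts_tilde Cs_tilde Tl_tilde Cl_tilde :: "real \<Rightarrow> real \<Rightarrow> real"
  assumes "alloy_data m"
    and "T_inf m \<noteq> T_0l m" and "T_inf m \<noteq> T_0s m"
    and "0 < h0"
    and "((T_0 m - T_0l m) * k_l m) / ((T_0l m - T_inf m) * sqrt (pi * alpha_l m)) < h0"
    and "h0 < ((T_0 m - T_0s m) * k_l m) / ((T_0s m - T_inf m) * sqrt (pi * alpha_l m))"
    and "similarity_solution m h0 \<delta> s_hat Tk_hat Ts_hat Cs_hat Tl_hat Cl_hat"
    and "T1 = Tk_hat - (h0 * sqrt (pi * alpha_s m) * erf \<delta> * (Tk_hat - T_inf m)) /
                         (k_s m + h0 * sqrt (pi * alpha_s m) * erf \<delta>)"
    and "rubinstein_solution m T1 \<mu> s_tilde Tk_tilde Ts_tilde Cs_tilde Tl_tilde Cl_tilde"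
  shows "sqrt (alpha_l m) / sqrt (alpha_s m) * (k_s m / k_l m) *
           ((Tk_tilde - T1) / (T_0 m - T_0s m)) * ((T_0s m - T_inf m) / (T1 - T_inf m)) < erf \<mu> \<and>
         erf \<mu> < sqrt (alpha_l m) / sqrt (alpha_s m) * (k_s m / k_l m) *
           ((Tk_tilde - T1) / (T_0 m - T_0l m)) * ((T_0l m - T_inf m) / (T1 - T_inf m))"
proof -
  note a = assms(1) and h = \<open>0 < h0\<close>
  note pos = a[unfolded alloy_data_def]
  have p: "similarity_pair m h0 \<delta> Tk_hat" and r: "rubinstein_pair m T1 \<mu> Tk_tilde"
    using assms(7,9) by (auto simp: similarity_solution_def rubinstein_solution_def)
  then have d: "0 < \<delta>" and T: "Tk_hat = W m h0 \<delta>" and T_le: "Tk_hat < T_0l m"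
    using pair_below_T_0l[OF a] by (auto simp: similarity_pair_def)
  have T1: "T1 = face_temperature m h0 \<delta> Tk_hat"
    using assms(8) by (simp add: face_temperature_def)
  define b where "b = h0 * sqrt (pi * alpha_s m) * erf \<delta>"
  have e: "0 < erf \<delta>" by (rule erf_pos[OF d])
  have b: "0 < b" using e h pos by (simp add: b_def)
  note T_order = T_0s_less_T_0l[OF a] T_0l_less_T_0[OF a]
  \<comment> \<open>Otherwise the upper bound on \<open>h0\<close> would not be positive.\<close>
  have s: "0 < T_0s m - T_inf m"
  proof (rule ccontr)
    assume "\<not> ?thesis"
    then have "(T_0 m - T_0s m) * k_l m / ((T_0s m - T_inf m) * sqrt (pi * alpha_l m)) \<le> 0"
      using T_order pos by (intro divide_nonneg_nonpos mult_nonpos_nonneg) auto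
    with assms(6) h show False by linarith
  qed
  have "T_inf m < Tk_hat" using W_gt_T_inf[OF a d h] s T_order T by simp
  then have gap_eq: "T1 - T_inf m = k_s m * (Tk_hat - T_inf m) / (k_s m + b)"
    using face_temperature_minus_T_inf[OF a d h, of Tk_hat]
    by (simp add: T1 b_def)
  have diff: "Tk_hat - T1 = b * (Tk_hat - T_inf m) / (k_s m + b)"
    using assms(8) by (simp add: b_def)
  have ratio: "(Tk_hat - T1) / (T1 - T_inf m) = b / k_s m"
    unfolding diff gap_eq using \<open>T_inf m < Tk_hat\<close> b pos by simp
  have "T1 \<le> Tk_hat"
    using diff b \<open>T_inf m < Tk_hat\<close> pos by (smt (verit) divide_nonneg_nonneg mult_nonneg_nonneg)
  then have "\<delta> = \<mu> \<and> Tk_hat = Tk_tilde"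
    using rubinstein_pair_unique[OF a _ _ r] similarity_pair_is_rubinstein_pair[OF a h p] T1 T_le T_order
    by simp
  then have eq: "\<mu> = \<delta>" "Tk_tilde = Tk_hat" by auto
  define \<beta> where "\<beta> = h0 * sqrt (pi * alpha_l m) / k_l m"
  have bound: "sqrt (alpha_l m) / sqrt (alpha_s m) * (k_s m / k_l m) *
       ((Tk_hat - T1) / X) * (Y / (T1 - T_inf m)) = \<beta> * (Y / X) * erf \<delta>" for X Y
  proof -
    have "((Tk_hat - T1) / X) * (Y / (T1 - T_inf m)) = (Tk_hat - T1) / (T1 - T_inf m) * (Y / X)"
      by simp
    then have "sqrt (alpha_l m) / sqrt (alpha_s m) * (k_s m / k_l m) *
        ((Tk_hat - T1) / X) * (Y / (T1 - T_inf m)) =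
        sqrt (alpha_l m) / sqrt (alpha_s m) * (k_s m / k_l m) * (b / k_s m * (Y / X))"
      unfolding ratio by (simp only: mult.assoc)
    also have "\<dots> = \<beta> * (Y / X) * erf \<delta>"
      using pos by (simp add: \<beta>_def b_def real_sqrt_mult)
    finally show ?thesis .
  qed
  have l1: "\<beta> * ((T_0s m - T_inf m) / (T_0 m - T_0s m)) < 1"
    using assms(6) s T_order pos by (simp add: \<beta>_def field_simps)
  have l2: "1 < \<beta> * ((T_0l m - T_inf m) / (T_0 m - T_0l m))"
    using assms(5) s T_order pos by (simp add: \<beta>_def field_simps)
  show ?thesis
    unfolding eq bound using mult_strict_right_mono[OF l1 e] mult_strict_right_mono[OF l2 e] by simp
qed

end
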